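(* For every integer $n\ge 0$ and every real $x$, $$\beta_{n,\lambda}^{Y}(x)=\sum_{j=0}^{n}\sum_{k=0}^{j}\binom{n}{j}\beta_{n-j,\lambda}^{Y}\langle x\rangle_{k,\lambda}(-1)^{j-k}S_{1,\lambda}^{Y}(j,k).$$
   Context: $\lambda$ is a fixed nonzero real number. For real $x$ and $n\ge1$: $(x)_{n,\lambda}=x(x-\lambda)\cdots(x-(n-1)\lambda)$, $\langle x\rangle_{n,\lambda}=x(x+\lambda)\cdots(x+(n-1)\lambda)$, and $(x)_{0,\lambda}=\langle x\rangle_{0,\lambda}=1$. The degenerate exponential is $e_{\lambda}^{x}(t)=(1+\lambda t)^{x/\lambda}=\sum_{n\ge0}(x)_{n,\lambda}\frac{t^n}{n!}$. The degenerate logarithm is, for $\mu\ne0$ and $u>0$, $\log_{\mu}(u)=\frac{1}{\mu}(u^{\mu}-1)$; in particular $\log_{-\lambda}(u)=-\frac1\lambda(u^{-\lambda}-1)$. $Y$ is a real random variable whose degenerate moment generating functions exist near the origin: for every nonzero real $\lambda$ there is $r=r(\lambda)>0$ with $E[e_{\lambda}^{Y}(t)]=\sum_{n\ge0}E[(Y)_{n,\lambda}]\frac{t^n}{n!}$ for $|t|<r$. All generating-function identities are power series expansions at $t=0$. Probabilistic degenerate Stirling numbers of the first kind: $\frac{1}{k!}\big(\log_{-\lambda}(E[e_{\lambda}^{Y}(t)])\big)^k=\sum_{n\ge k}(-1)^{n-k}S_{1,\lambda}^{Y}(n,k)\frac{t^n}{n!}$, $k\ge0$. The probabilistic degenerate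 Bernoulli polynomials associated with $Y$ are defined by $\frac{t}{E[e_{\lambda}^{Y}(t)]-1}\big(E[e_{\lambda}^{Y}(t)]\big)^{x}=\sum_{n\ge0}\beta_{n,\lambda}^{Y}(x)\frac{t^n}{n!}$, where it is implicit that the left side has a power series expansion at $t=0$, i.e. $E[Y]\neq0$; and $\beta_{n,\lambda}^{Y}=\beta_{n,\lambda}^{Y}(0)$. *)

theory Defs
  imports "HOL-Probability.Probability"
begin

definition deg_falling :: "real \<Rightarrow> real \<Rightarrow> nat \<Rightarrow> real" where
  "deg_falling lam x n = (\<Prod>i<n. x - real i * lam)"

definition deg_rising :: "real \<Rightarrow> real \<Rightarrow> nat \<Rightarrow> real" where
  "deg_rising lam x n = (\<Prod>i<n. x + real i * lam)"

definition deg_exp :: "real \<Rightarrow> real \<Rightarrow> real \<Rightarrow> real" where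
  "deg_exp lam x t = (1 + lam * t) powr (x / lam)"

definition deg_log :: "real \<Rightarrow> real \<Rightarrow> real" where
  "deg_log mu u = (u powr mu - 1) / mu"

definition deg_mgf :: "'a measure \<Rightarrow> ('a \<Rightarrow> real) \<Rightarrow> real \<Rightarrow> real \<Rightarrow> real" where
  "deg_mgf M Y lam t = (LINT \<omega>|M. deg_exp lam (Y \<omega>) t)"

text \<open>
  The bound \<open>r * \<bar>lam\<bar> \<le> 1\<close> only ensures that the base \<open>1 + lam * t\<close> is positive
  for \<open>\<bar>t\<bar> < r\<close>; since \<open>r\<close> may always be decreased, it is no restriction.
  Integrability is required explicitly because the Bochner integral of a non-integrable
  function is \<open>0\<close>.
\<close>

definition deg_mgfs_exist :: "'a measure \<Rightarrow> ('a \<Rightarrow> real) \<Rightarrow> bool" where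
  "deg_mgfs_exist M Y \<longleftrightarrow>
     (\<forall>lam. lam \<noteq> 0 \<longrightarrow>
        (\<forall>n. integrable M (\<lambda>\<omega>. deg_falling lam (Y \<omega>) n)) \<and>
        (\<exists>r>0. r * \<bar>lam\<bar> \<le> 1 \<and>
           (\<forall>t. \<bar>t\<bar> < r \<longrightarrow>
              integrable M (\<lambda>\<omega>. deg_exp lam (Y \<omega>) t) \<and>
              (\<lambda>n. (LINT \<omega>|M. deg_falling lam (Y \<omega>) n) * (t ^ n / fact n))
                sums deg_mgf M Y lam t)))"

text \<open>
  \<open>has_egf f a\<close>: the power series expansion of \<open>f\<close> at \<open>0\<close> is
  \<open>\<Sum>n. a n * t ^ n / n!\<close>. The point \<open>t = 0\<close> itself is left out, so that removable
  singularities such as that of \<open>t / (g t - 1)\<close> with \<open>g 0 = 1\<close> (where HOL division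
  by zero would yield \<open>0\<close>) are filled in by continuity.
\<close>

definition has_egf :: "(real \<Rightarrow> real) \<Rightarrow> (nat \<Rightarrow> real) \<Rightarrow> bool" where
  "has_egf f a \<longleftrightarrow> (\<forall>\<^sub>F t in at 0. (\<lambda>n. a n * (t ^ n / fact n)) sums f t)"

text \<open>The coefficient sequence is determined, so definite description is meaningful below.\<close>

lemma has_egf_unique:
  assumes "has_egf f a" and "has_egf f b"
  shows "a = b"
proof (rule ccontr)
  assume "a \<noteq> b"
  define c where "c = (\<lambda>n. (a n - b n) / fact n)"
  from \<open>a \<noteq> b\<close> have ex: "\<exists>n. c n \<noteq> 0" by (auto simp: c_def fun_eq_iff)
  define m where "m = (LEAST n. c n \<noteq> 0)"
  have cm: "c m \<noteq> 0" using ex unfolding m_def by (rule LeastI_ex)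
  have lt: "c n = 0" if "n < m" for n using not_less_Least[OF that[unfolded m_def]] by simp
  have "\<forall>\<^sub>F t in at 0. (\<lambda>n. c n * t ^ n) sums 0"
    using assms[unfolded has_egf_def]
  proof eventually_elim
    case (elim t)
    from sums_diff[OF this] show ?case by (simp add: c_def left_diff_distrib diff_divide_distrib)
  qed
  then obtain s where s: "s > 0" "\<And>t. t \<noteq> 0 \<Longrightarrow> \<bar>t\<bar> < s \<Longrightarrow> (\<lambda>n. c n * t ^ n) sums 0"
    by (auto simp: eventually_at)
  have "(\<lambda>n. c (n + m) * t ^ n) sums 0" if "t \<noteq> 0" "norm t < s" for t
  proof -
    have "(\<Sum>i<m. c i * t ^ i) = 0" by (rule sum.neutral) (simp add: lt)
    with sums_split_initial_segment[OF s(2), of t m] that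
    have "(\<lambda>n. c (n + m) * t ^ (n + m)) sums 0" by simp
    from sums_divide[OF this, of "t ^ m"] show ?thesis using that by (simp add: power_add)
  qed
  from powser_limit_0_strong[OF s(1) this] have "((\<lambda>_. 0) \<longlongrightarrow> c m) (at (0::real))" by simp
  with cm show False by (simp add: tendsto_const_iff)
qed

text \<open>Probabilistic degenerate Stirling numbers of the first kind; the expansion defining
  them starts at \<open>n = k\<close>, i.e. they vanish for \<open>n < k\<close>.\<close>

definition prob_deg_stirling1 ::
    "'a measure \<Rightarrow> ('a \<Rightarrow> real) \<Rightarrow> real \<Rightarrow> nat \<Rightarrow> nat \<Rightarrow> real" where
  "prob_deg_stirling1 M Y lam n k =
     (THE S. (\<forall>i<k. S i = 0) \<and>
        has_egf (\<lambda>t. 1 / fact k * deg_log (- lam) (deg_mgf M Y lam t) ^ k)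
                (\<lambda>i. (- 1) ^ (i - k) * S i)) n"

definition prob_deg_bernoulli ::
    "'a measure \<Rightarrow> ('a \<Rightarrow> real) \<Rightarrow> real \<Rightarrow> nat \<Rightarrow> real \<Rightarrow> real" where
  "prob_deg_bernoulli M Y lam n x =
     (THE b. has_egf (\<lambda>t. t / (deg_mgf M Y lam t - 1) * deg_mgf M Y lam t powr x) b) n"

end

theory Submission
  imports Defs "HOL-Complex_Analysis.Complex_Analysis"
begin

text \<open>
  Write \<open>g\<close> for the degenerate moment generating function and \<open>L = log_{-\<lambda>} g\<close>. Then
  \<open>g^x = (1 - \<lambda> L)^(-x/\<lambda>) = \<Sum>k. \<langle>x\<rangle>_{k,\<lambda>} L^k / k!\<close>. Since \<open>L\<close> vanishes at \<open>0\<close>, this is a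
  composition of power series, in which each coefficient is a finite sum of the numbers
  \<open>S_{1,\<lambda>}^Y(j,k)\<close>; multiplying by the series of \<open>t / (g - 1)\<close> gives the claim.
\<close>

text \<open>
  The library proves that expansions compose only over \<open>complex\<close>; the embedding below carries
  this over to \<open>real\<close>.
\<close>

definition complex_fps :: "real fps \<Rightarrow> complex fps" where
  "complex_fps F = Abs_fps (\<lambda>n. of_real (fps_nth F n))"

lemma complex_fps_nth [simp]: "fps_nth (complex_fps F) n = of_real (fps_nth F n)"
  by (simp add: complex_fps_def)

lemma complex_fps_mult: "complex_fps (F * G) = complex_fps F * complex_fps G"
  by (simp add: fps_eq_iff fps_mult_nth)

lemma complex_fps_power: "complex_fps (F ^ n) = complex_fps F ^ n"
  by (induction n) (auto simp: complex_fps_mult, simp add: fps_eq_iff)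

lemma complex_fps_compose: "complex_fps (F oo G) = complex_fps F oo complex_fps G"
  by (simp add: fps_eq_iff fps_compose_nth complex_fps_power [symmetric])

lemma fps_conv_radius_complex_fps [simp]: "fps_conv_radius (complex_fps F) = fps_conv_radius F"
  unfolding fps_conv_radius_def by (intro conv_radius_cong) auto

lemma eval_complex_fps:
  assumes "norm t < fps_conv_radius F"
  shows "eval_fps (complex_fps F) (of_real t) = of_real (eval_fps F t)"
proof -
  have "(\<lambda>n. of_real (fps_nth F n * t ^ n)) sums (of_real (eval_fps F t) :: complex)"
    by (intro sums_of_real sums_eval_fps assms)
  thus ?thesis by (simp add: eval_fps_def sums_iff)
qed

section \<open>Power series expansions of real functions\<close>

lemma eventually_in_fps_conv_radius:
  fixes F :: "'a :: {banach, real_normed_div_algebra} fps"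
  assumes "fps_conv_radius F > 0"
  shows "eventually (\<lambda>t. ereal (norm t) < fps_conv_radius F) (nhds 0)"
proof -
  have "eventually (\<lambda>t. t \<in> eball 0 (fps_conv_radius F)) (nhds 0)"
    using assms by (intro eventually_nhds_in_open) (auto simp: zero_ereal_def)
  thus ?thesis by eventually_elim simp
qed

lemma has_fps_expansion_imp_0:
  fixes F :: "'a :: {banach, real_normed_div_algebra} fps"
  assumes "f has_fps_expansion F"
  shows "f 0 = fps_nth F 0"
proof -
  have "eval_fps F 0 = f 0"
    using assms by (auto simp: has_fps_expansion_def dest: eventually_nhds_x_imp_x)
  thus ?thesis by (simp add: eval_fps_at_0)
qed

lemma has_fps_expansion_imp_filterlim:
  fixes F :: "'a :: {banach, real_normed_field} fps"
  assumes "f has_fps_expansion F"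
  shows "filterlim f (nhds (fps_nth F 0)) (nhds 0)"
proof -
  have "isCont f 0" using has_fps_expansion_imp_continuous[OF assms, of UNIV] by simp
  hence "filterlim f (nhds (f 0)) (nhds 0)"
    by (simp add: isCont_def tendsto_at_iff_tendsto_nhds)
  thus ?thesis using has_fps_expansion_imp_0[OF assms] by simp
qed

text \<open>The complex result is applied to the sums of the embedded series and then read off at
  real arguments. As \<open>G\<close> has constant term 0, \<open>g t\<close> tends to 0 and so ends
  up inside the disc of convergence of \<open>F\<close>.\<close>

lemma has_fps_expansion_compose_real:
  fixes f g :: "real \<Rightarrow> real"
  assumes F: "f has_fps_expansion F" and G: "g has_fps_expansion G" and G0: "fps_nth G 0 = 0"
  shows "(\<lambda>t. f (g t)) has_fps_expansion (F oo G)"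
proof -
  let ?F = "complex_fps F" and ?G = "complex_fps G"
  have rF: "fps_conv_radius F > 0" and rG: "fps_conv_radius G > 0"
    using F G by (auto simp: has_fps_expansion_def)
  have "(eval_fps ?F \<circ> eval_fps ?G) has_fps_expansion (?F oo ?G)"
    using rF rG G0
    by (intro has_fps_expansion_compose eval_fps_has_fps_expansion) auto
  hence rFG: "fps_conv_radius (F oo G) > 0"
    and ev: "\<forall>\<^sub>F z in nhds 0. eval_fps (complex_fps (F oo G)) z = eval_fps ?F (eval_fps ?G z)"
    by (auto simp: has_fps_expansion_def simp flip: complex_fps_compose)
  have "filterlim (of_real :: real \<Rightarrow> complex) (nhds 0) (nhds 0)"
    using tendsto_of_real[OF filterlim_ident, of "0::real", where 'a = complex] by simp
  from eventually_compose_filterlim[OF ev this]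
  have ev': "\<forall>\<^sub>F t in nhds 0. eval_fps (complex_fps (F oo G)) (of_real t) =
      eval_fps ?F (eval_fps ?G (of_real t))" .
  have g_lim: "filterlim g (nhds 0) (nhds 0)"
    using has_fps_expansion_imp_filterlim[OF G] G0 by simp
  have evF: "\<forall>\<^sub>F t in nhds 0. eval_fps F (g t) = f (g t)"
    using F by (intro eventually_compose_filterlim[OF _ g_lim]) (simp add: has_fps_expansion_def)
  have evrF: "\<forall>\<^sub>F t in nhds 0. ereal (norm (g t)) < fps_conv_radius F"
    by (intro eventually_compose_filterlim[OF _ g_lim] eventually_in_fps_conv_radius rF)
  have evG: "\<forall>\<^sub>F t in nhds 0. eval_fps G t = g t"
    using G by (simp add: has_fps_expansion_def)
  have "\<forall>\<^sub>F t in nhds 0. eval_fps (F oo G) t = f (g t)"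
    using ev' evF evrF evG eventually_in_fps_conv_radius[OF rG] eventually_in_fps_conv_radius[OF rFG]
  proof eventually_elim
    case (elim t)
    have "complex_of_real (eval_fps (F oo G) t) = of_real (eval_fps F (g t))"
      using elim by (simp add: eval_complex_fps)
    thus ?case using elim by simp
  qed
  with rFG show ?thesis by (simp add: has_fps_expansion_def)
qed

text \<open>Newton's binomial series in \<open>u = f t - 1\<close>; the constant term 1 of
  \<open>F\<close> makes \<open>u\<close> vanish at 0.\<close>

lemma has_fps_expansion_powr_real:
  fixes f :: "real \<Rightarrow> real"
  assumes "f has_fps_expansion F" and "fps_nth F 0 = 1"
  shows "(\<lambda>t. f t powr c) has_fps_expansion (fps_binomial c oo (F - 1))"
proof -
  have "(\<lambda>u. (1 + u) powr c) has_fps_expansion fps_binomial c"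
    unfolding has_fps_expansion_def
  proof
    show "fps_conv_radius (fps_binomial c) > 0"
      by (simp add: fps_conv_radius_def conv_radius_gchoose)
    have "\<forall>\<^sub>F u::real in nhds 0. \<bar>u\<bar> < 1"
      using eventually_nhds_in_open[of "ball (0::real) 1" 0] by simp
    thus "\<forall>\<^sub>F u in nhds 0. eval_fps (fps_binomial c) u = (1 + u) powr c"
      by eventually_elim (use gen_binomial_real in \<open>simp add: eval_fps_def sums_iff\<close>)
  qed
  from has_fps_expansion_compose_real[OF this has_fps_expansion_diff[OF assms(1) has_fps_expansion_1]]
  show ?thesis using assms(2) by simp
qed

text \<open>Allowing \<open>f'\<close> to differ from \<open>f\<close> at 0 matters for
  \<open>t / (g t - 1)\<close>, whose HOL value at 0 is not its limit.\<close>

lemma has_fps_expansion_imp_has_egf: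
  assumes "f has_fps_expansion F" and "\<forall>\<^sub>F t in at 0. f' t = f t"
  shows "has_egf f' (\<lambda>n. fact n * fps_nth F n)"
proof -
  have "\<forall>\<^sub>F t in at 0. eval_fps F t = f t" "\<forall>\<^sub>F t in at 0. ereal (norm t) < fps_conv_radius F"
    using assms(1) eventually_in_fps_conv_radius[of F]
    by (auto simp: has_fps_expansion_def eventually_at_filter elim: eventually_mono)
  with assms(2) show ?thesis unfolding has_egf_def
  proof eventually_elim
    case (elim t)
    thus ?case using sums_eval_fps[of t F] by simp
  qed
qed

lemma sums_imp_has_fps_expansion:
  fixes f :: "real \<Rightarrow> real"
  assumes "r > 0" and "\<And>t. \<bar>t\<bar> < r \<Longrightarrow> (\<lambda>n. c n * t ^ n) sums f t"
  shows "f has_fps_expansion Abs_fps c"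
  unfolding has_fps_expansion_def
proof
  have "conv_radius c \<ge> r"
    by (intro conv_radius_geI_ex' sums_summable[OF assms(2)]) auto
  with \<open>r > 0\<close> show "fps_conv_radius (Abs_fps c) > 0"
    by (simp add: fps_conv_radius_def less_le_trans[of 0 "ereal r"])
  have "\<forall>\<^sub>F t::real in nhds 0. \<bar>t\<bar> < r"
    using eventually_nhds_in_open[of "ball (0::real) r" 0] assms(1) by simp
  thus "\<forall>\<^sub>F t in nhds 0. eval_fps (Abs_fps c) t = f t"
    by eventually_elim (use assms in \<open>auto simp: eval_fps_def sums_iff\<close>)
qed

text \<open>Identifies the coefficients of \<open>(1 - lam * u) powr (- x / lam)\<close> as a series
  in \<open>u\<close>.\<close>

lemma deg_rising_gbinomial:
  assumes "lam \<noteq> 0"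
  shows "(- x / lam gchoose k) * (- lam) ^ k = deg_rising lam x k / fact k"
proof -
  have "(\<Prod>i<k. - x / lam - real i) * (- lam) ^ k = (\<Prod>i<k. (- x / lam - real i) * (- lam))"
    by (simp only: prod.distrib prod_constant card_lessThan)
  also have "\<dots> = deg_rising lam x k"
    unfolding deg_rising_def using assms by (intro prod.cong) (auto simp: field_simps)
  finally show ?thesis
    by (simp add: gbinomial_prod_rev atLeast0LessThan)
qed

section \<open>Expansions and coefficient sequences attached to \<open>Y\<close>\<close>

lemma deg_mgf_has_fps_expansion:
  assumes "deg_mgfs_exist M Y" and "lam \<noteq> 0"
  shows "deg_mgf M Y lam has_fps_expansion
    Abs_fps (\<lambda>n. (LINT \<omega>|M. deg_falling lam (Y \<omega>) n) / fact n)"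
  using assms unfolding deg_mgfs_exist_def
  by (fastforce intro: sums_imp_has_fps_expansion)

lemma prob_deg_stirling1_eq:
  assumes L: "(\<lambda>t. deg_log (- lam) (deg_mgf M Y lam t)) has_fps_expansion L"
    and L0: "fps_nth L 0 = 0"
  shows "(- 1) ^ (j - k) * prob_deg_stirling1 M Y lam j k = fact j * fps_nth (L ^ k) j / fact k"
proof -
  let ?f = "\<lambda>t. 1 / fact k * deg_log (- lam) (deg_mgf M Y lam t) ^ k"
  let ?b = "\<lambda>i. fact i * fps_nth (fps_const (1 / fact k) * L ^ k) i"
  have b: "has_egf ?f ?b"
    by (rule has_fps_expansion_imp_has_egf[OF has_fps_expansion_cmult_left
          [OF has_fps_expansion_power[OF L], of "1 / fact k" k]]) simp
  \<comment> \<open>A sign is its own inverse, so multiplying by it once more solves for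
    \<open>S\<close>. For \<open>i < k\<close> the exponent truncates to 0, which is harmless
    because \<open>L ^ k\<close> has no terms below degree \<open>k\<close>.\<close>
  define S where "S = (\<lambda>i. (- 1) ^ (i - k) * ?b i)"
  have sign: "(- 1) ^ m * ((- 1) ^ m * (a::real)) = a" for m a
    by (simp flip: mult.assoc power_add)
  have "prob_deg_stirling1 M Y lam j k = S j"
    unfolding prob_deg_stirling1_def
  proof (subst the_equality)
    show "(\<forall>i<k. S i = 0) \<and> has_egf ?f (\<lambda>i. (- 1) ^ (i - k) * S i)"
      using b startsby_zero_power_prefix[OF L0, of k] by (simp only: S_def sign) simp
  next
    fix T assume T: "(\<forall>i<k. T i = 0) \<and> has_egf ?f (\<lambda>i. (- 1) ^ (i - k) * T i)"
    hence "(\<lambda>i. (- 1) ^ (i - k) * T i) = ?b" using has_egf_unique b by blast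
    hence "(- 1) ^ (i - k) * T i = ?b i" for i by (rule fun_cong)
    thus "T = S" unfolding S_def by (metis sign)
  qed simp
  thus ?thesis by (simp only: S_def sign) simp
qed

lemma prob_deg_bernoulli_eq:
  assumes "f has_fps_expansion F"
    and "\<forall>\<^sub>F t in at 0. t / (deg_mgf M Y lam t - 1) * deg_mgf M Y lam t powr x = f t"
  shows "prob_deg_bernoulli M Y lam n x = fact n * fps_nth F n"
  using has_fps_expansion_imp_has_egf[OF assms] has_egf_unique
  unfolding prob_deg_bernoulli_def by (subst the_equality) blast+

theorem theorem2p10:
  fixes M :: "'a measure" and Y :: "'a \<Rightarrow> real" and lam x :: real and n :: nat
  assumes "prob_space M"
    and "Y \<in> borel_measurable M"
    and "deg_mgfs_exist M Y"
    and "(LINT \<omega>|M. Y \<omega>) \<noteq> 0"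
    and "lam \<noteq> 0"
  shows "prob_deg_bernoulli M Y lam n x =
    (\<Sum>j=0..n. \<Sum>k=0..j.
       real (n choose j) * prob_deg_bernoulli M Y lam (n - j) 0 * deg_rising lam x k
         * (- 1) ^ (j - k) * prob_deg_stirling1 M Y lam j k)"
proof -
  interpret prob_space M by fact
  define g where "g = deg_mgf M Y lam"
  define G where "G = Abs_fps (\<lambda>n. (LINT \<omega>|M. deg_falling lam (Y \<omega>) n) / fact n)"
  have G: "g has_fps_expansion G"
    unfolding g_def G_def by (rule deg_mgf_has_fps_expansion) fact+
  \<comment> \<open>These coefficients are the total mass of \<open>M\<close> and the mean of
    \<open>Y\<close>.\<close>
  have G0: "fps_nth G 0 = 1" and G1: "fps_nth G 1 \<noteq> 0"
    using assms(4) by (simp_all add: G_def deg_falling_def prob_space)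
  have g_pos: "\<forall>\<^sub>F t in nhds 0. g t > 0"
    using order_tendstoD(1)[OF has_fps_expansion_imp_filterlim[OF G]] G0 by simp

  define l where "l = (\<lambda>t. deg_log (- lam) (g t))"
  define L where "L = ((fps_binomial (- lam) oo (G - 1)) - 1) * fps_const (1 / (- lam))"
  have "(\<lambda>t. (g t powr (- lam) - 1) * (1 / (- lam))) has_fps_expansion L"
    unfolding L_def
    by (intro has_fps_expansion_cmult_right has_fps_expansion_diff has_fps_expansion_1
        has_fps_expansion_powr_real G G0)
  hence L: "l has_fps_expansion L" by (simp add: l_def deg_log_def)
  have L0: "fps_nth L 0 = 0" by (simp add: L_def)

  \<comment> \<open>The series of \<open>g t powr x\<close>, built through \<open>L\<close> so that
    the powers \<open>L ^ k\<close>, and with them the Stirling numbers, appear in its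
    coefficients.\<close>
  define P where "P = fps_binomial (- x / lam) oo (fps_const (- lam) * fps_X) oo L"
  have P: "(\<lambda>t. (1 + (- lam) * l t) powr (- x / lam)) has_fps_expansion P"
  proof -
    have "(\<lambda>u. 1 + (- lam) * u) has_fps_expansion 1 + fps_const (- lam) * fps_X"
      by (intro has_fps_expansion_add has_fps_expansion_1 has_fps_expansion_cmult_left
          has_fps_expansion_fps_X)
    from has_fps_expansion_compose_real[OF has_fps_expansion_powr_real[OF this] L L0]
    show ?thesis by (simp add: P_def)
  qed
  \<comment> \<open>Undoing the degenerate logarithm gives \<open>g t powr (- lam)\<close> as base,
    and the exponents multiply to \<open>x\<close>.\<close>
  have powr_eq: "\<forall>\<^sub>F t in nhds 0. (1 + (- lam) * l t) powr (- x / lam) = g t powr x"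
    using g_pos
  proof eventually_elim
    case (elim t)
    have "1 + (- lam) * l t = g t powr (- lam)"
      using assms(5) by (simp add: l_def deg_log_def)
    with elim assms(5) show ?case by (simp add: powr_powr)
  qed
  have P_nth: "fps_nth P j = (\<Sum>k=0..j. deg_rising lam x k / fact k * fps_nth (L ^ k) j)" for j
    unfolding P_def fps_compose_nth[of _ L] fps_nth_compose_linear fps_binomial_nth
      mult.commute[of "(- lam) ^ _"] deg_rising_gbinomial[OF assms(5)] ..

  \<comment> \<open>The removable singularity is filled with the limit, the reciprocal of the mean
    of \<open>Y\<close>.\<close>
  define h where "h = (\<lambda>t. if t = 0 then 1 / fps_nth G 1 else t / (g t - 1))"
  define B where "B = fps_X / (G - 1)"
  have B: "h has_fps_expansion B"
  proof -
    \<comment> \<open>Numerator and denominator both vanish to order exactly 1, so the quotient is a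
      power series with constant term \<open>1 / fps_nth G 1\<close>.\<close>
    have "subdegree (G - 1) = 1" using G0 G1 by (intro subdegreeI) auto
    moreover from this have "G - 1 \<noteq> 0" by auto
    ultimately show ?thesis
      unfolding h_def B_def using G1
      by (intro has_fps_expansion_divide has_fps_expansion_fps_X has_fps_expansion_diff G
          has_fps_expansion_1) auto
  qed
  have h_eq: "\<forall>\<^sub>F t in at 0. h t = t / (g t - 1)"
    by (auto simp: h_def eventually_at_filter)
  have g_pos': "\<forall>\<^sub>F t in at 0. g t > 0"
    and powr_eq': "\<forall>\<^sub>F t in at 0. (1 + (- lam) * l t) powr (- x / lam) = g t powr x"
    using g_pos powr_eq by (auto simp: eventually_at_filter elim: eventually_mono)

  \<comment> \<open>Positivity of \<open>g\<close> enters because \<open>0 powr 0\<close> is 0 in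
    HOL.\<close>
  have "\<forall>\<^sub>F t in at 0. t / (deg_mgf M Y lam t - 1) * deg_mgf M Y lam t powr 0 = h t"
    using h_eq g_pos' unfolding g_def by eventually_elim simp
  note beta0 = prob_deg_bernoulli_eq[OF B this]
  have "\<forall>\<^sub>F t in at 0. t / (deg_mgf M Y lam t - 1) * deg_mgf M Y lam t powr x =
      h t * (1 + (- lam) * l t) powr (- x / lam)"
    using h_eq powr_eq' unfolding g_def by eventually_elim simp
  note beta = prob_deg_bernoulli_eq[OF has_fps_expansion_mult[OF B P] this]
  have S: "(- 1) ^ (j - k) * prob_deg_stirling1 M Y lam j k = fact j * fps_nth (L ^ k) j / fact k"
    for j k
    using L L0 unfolding l_def g_def by (rule prob_deg_stirling1_eq)

  \<comment> \<open>The factors are swapped so that the Cauchy product runs over the index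
    \<open>j\<close> of \<open>P\<close>, as in the claim.\<close>
  have "prob_deg_bernoulli M Y lam n x = fact n * (\<Sum>j=0..n. fps_nth P j * fps_nth B (n - j))"
    unfolding beta mult.commute[of B] fps_mult_nth ..
  also have "\<dots> = (\<Sum>j=0..n. \<Sum>k=0..j. fact n / fact j * fps_nth B (n - j) * deg_rising lam x k
      * ((- 1) ^ (j - k) * prob_deg_stirling1 M Y lam j k))"
    unfolding S P_nth sum_distrib_left sum_distrib_right
    by (intro sum.cong refl) simp
  also have "\<dots> = (\<Sum>j=0..n. \<Sum>k=0..j.
       real (n choose j) * prob_deg_bernoulli M Y lam (n - j) 0 * deg_rising lam x k
         * (- 1) ^ (j - k) * prob_deg_stirling1 M Y lam j k)"
    \<comment> \<open>The factor \<open>fact (n - j)\<close> from \<open>beta0\<close> cancels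
      against the one in the binomial coefficient.\<close>
    unfolding beta0 by (intro sum.cong refl) (simp add: binomial_fact)
  finally show ?thesis .
qed

end
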